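(* Let $r\geq 1$ be an integer, let $N$ be a three-dimensional space form of constant non-positive sectional curvature $K\leq 0$, let $I\subset\mathbb{R}$ be an interval, and let $\gamma\colon I\to N$ be an $r$-harmonic curve parametrized by arclength. Assume that the geodesic curvature $k$ and the torsion $\tau$ of $\gamma$ are constant. Then $\gamma$ is a geodesic.
   Context: For a smooth curve $\gamma\colon I\to N$ into a Riemannian manifold $(N,h)$, $T=\gamma'$ is its tangent vector, $\nabla_T$ is the covariant derivative along $\gamma$ (induced by the Levi-Civita connection of $N$), and $\nabla_T^jT$ denotes its $j$-fold iterate applied to $T$, with $\nabla_T^0T=T$. The curve $\gamma$ is called $r$-harmonic (polyharmonic of order $r$) if it is a critical point of the $r$-energy $E_r(\gamma)=\int_I|\nabla_T^{r-1}T|^2\,ds$, i.e. if it solves $$\nabla^{2r-1}_TT+\sum_{l=0}^{r-2}(-1)^lR^N(\nabla_T^{2r-3-l}T,\nabla_T^lT)T=0$$ (the sum being empty for $r=1$), where $R^N$ is the curvature tensor of $N$, with sign convention such that on a space form of sectional curvature $K$ one has $R^N(X,Y)Z=K(\langle Z,Y\rangle X-\langle Z,X\rangle Y)$. A geodesic is a curve with $\nabla_TT=0$. For an arclength-parametrized curve in a three-dimensional space form with orthonormal Frenet frame $\{T,F_2,F_3\}$, the geodesic curvature $k$ and the torsion $\tau$ are defined by the Frenet equations $$\nabla_TT=kF_2,\qquad \nabla_TF_2=-kT+\tau F_3,\qquad \nabla_TF_3=-\tau F_2.$$ The curve is a geodesic exactly when $k=0$. *)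

theory Defs
  imports "HOL-Analysis.Analysis"
begin

section \<open>Smooth functions\<close>

text \<open>
  Derivatives are taken within \<open>S\<close>.  The notion is used only for open sets \<open>S\<close> and for
  relatively open subsets of a nondegenerate interval (one-sided derivatives at the end points);
  there, derivatives within \<open>S\<close> are unique.
\<close>

primrec C_k_on :: "nat \<Rightarrow> 'a::real_normed_vector set \<Rightarrow> ('a \<Rightarrow> 'b::real_normed_vector) \<Rightarrow> bool" where
  "C_k_on 0 S f \<longleftrightarrow> continuous_on S f"
| "C_k_on (Suc n) S f \<longleftrightarrow>
     (\<forall>x\<in>S. f differentiable (at x within S)) \<and>
     (\<forall>v. C_k_on n S (\<lambda>x. frechet_derivative f (at x within S) v))"

definition smooth_on :: "'a::real_normed_vector set \<Rightarrow> ('a \<Rightarrow> 'b::real_normed_vector) \<Rightarrow> bool" where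
  "smooth_on S f \<longleftrightarrow> (\<forall>n. C_k_on n S f)"


section \<open>Smooth and Riemannian manifolds\<close>

text \<open>
  The manifold is the whole type \<open>'m\<close>, whose topology is Hausdorff and second countable;
  a chart is a pair of a domain and a coordinate map.
\<close>

type_synonym ('m, 'n) chart = "'m set \<times> ('m \<Rightarrow> real^'n)"

abbreviation cdom :: "('m, 'n) chart \<Rightarrow> 'm set" where "cdom \<equiv> fst"
abbreviation cmap :: "('m, 'n) chart \<Rightarrow> 'm \<Rightarrow> real^'n" where "cmap \<equiv> snd"

definition transition :: "('m, 'n) chart \<Rightarrow> ('m, 'n) chart \<Rightarrow> real^'n \<Rightarrow> real^'n" where
  "transition c d = cmap d \<circ> inv_into (cdom c) (cmap c)"

text \<open>
  The differential of the coordinate change from \<open>c\<close> to \<open>d\<close> at the point \<open>p\<close>.  A tangent vector at \<open>p\<close>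
  is given by its components \<open>u c \<in> \<real>\<^sup>n\<close> in the charts \<open>c\<close> around \<open>p\<close>, where
  \<open>u d = transition_deriv c d p (u c)\<close>.
\<close>

definition transition_deriv ::
    "('m, 'n) chart \<Rightarrow> ('m, 'n) chart \<Rightarrow> 'm \<Rightarrow> real^'n \<Rightarrow> real^'n" where
  "transition_deriv c d p = frechet_derivative (transition c d) (at (cmap c p))"

locale smooth_manifold =
  fixes A :: "('m::{t2_space, second_countable_topology}, 'n::finite) chart set"
  assumes cover: "(\<Union>c\<in>A. cdom c) = UNIV"
    and open_dom: "c \<in> A \<Longrightarrow> open (cdom c)"
    and open_image: "c \<in> A \<Longrightarrow> open (cmap c ` cdom c)"
    and chart_homeomorphism: "c \<in> A \<Longrightarrow>
      homeomorphism (cdom c) (cmap c ` cdom c) (cmap c) (inv_into (cdom c) (cmap c))"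
    and smooth_transition: "c \<in> A \<Longrightarrow> d \<in> A \<Longrightarrow>
      smooth_on (cmap c ` (cdom c \<inter> cdom d)) (transition c d)"

text \<open>\<open>g c x\<close> is the Gram matrix of the metric in the chart \<open>c\<close> at the coordinate point \<open>x\<close>.\<close>

definition ip :: "real^'n^'n \<Rightarrow> real^'n \<Rightarrow> real^'n \<Rightarrow> real" where
  "ip G u v = (\<Sum>i\<in>UNIV. \<Sum>j\<in>UNIV. G $ i $ j * u $ i * v $ j)"

locale riemannian_manifold = smooth_manifold A
  for A :: "('m::{t2_space, second_countable_topology}, 'n::finite) chart set" +
  fixes g :: "('m, 'n) chart \<Rightarrow> real^'n \<Rightarrow> real^'n^'n"
  assumes smooth_metric: "c \<in> A \<Longrightarrow> smooth_on (cmap c ` cdom c) (g c)"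
    and metric_sym: "c \<in> A \<Longrightarrow> x \<in> cmap c ` cdom c \<Longrightarrow> transpose (g c x) = g c x"
    and metric_pos: "c \<in> A \<Longrightarrow> x \<in> cmap c ` cdom c \<Longrightarrow> u \<noteq> 0 \<Longrightarrow> ip (g c x) u u > 0"
    and metric_compat: "c \<in> A \<Longrightarrow> d \<in> A \<Longrightarrow> p \<in> cdom c \<inter> cdom d \<Longrightarrow>
      ip (g d (cmap d p)) (transition_deriv c d p u) (transition_deriv c d p v) =
      ip (g c (cmap c p)) u v"


section \<open>Levi-Civita connection and curvature in coordinates\<close>

definition pd :: "'n::finite \<Rightarrow> (real^'n \<Rightarrow> real) \<Rightarrow> real^'n \<Rightarrow> real" where
  "pd i f x = frechet_derivative f (at x) (axis i 1)"

text \<open>\<open>christoffel G l i j\<close> is \<open>\<Gamma>\<^sup>l\<^sub>i\<^sub>j\<close>, where \<open>\<nabla>\<^sub>i \<partial>\<^sub>j = \<Sum>l. \<Gamma>\<^sup>l\<^sub>i\<^sub>j \<partial>\<^sub>l\<close>.\<close>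

definition christoffel ::
    "(real^'n \<Rightarrow> real^'n^'n) \<Rightarrow> 'n::finite \<Rightarrow> 'n \<Rightarrow> 'n \<Rightarrow> real^'n \<Rightarrow> real" where
  "christoffel G l i j x = (1/2) * (\<Sum>m\<in>UNIV. matrix_inv (G x) $ l $ m *
     (pd i (\<lambda>y. G y $ j $ m) x + pd j (\<lambda>y. G y $ i $ m) x - pd m (\<lambda>y. G y $ i $ j) x))"

text \<open>
  The components of
  \<open>R(u,v)w = \<nabla>\<^sub>u \<nabla>\<^sub>v w - \<nabla>\<^sub>v \<nabla>\<^sub>u w - \<nabla>\<^bsub>[u,v]\<^esub> w\<close>.  With this sign, curvature \<open>K\<close> means
  \<open>R(u,v)w = K (\<langle>w,v\<rangle> u - \<langle>w,u\<rangle> v)\<close>.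
\<close>

definition curvature ::
    "(real^'n \<Rightarrow> real^'n^'n) \<Rightarrow> real^'n \<Rightarrow> real^'n \<Rightarrow> real^'n \<Rightarrow> real^'n \<Rightarrow> real^'n::finite" where
  "curvature G x u v w = (\<chi> l. \<Sum>i\<in>UNIV. \<Sum>j\<in>UNIV. \<Sum>k\<in>UNIV.
     (pd i (christoffel G l j k) x - pd j (christoffel G l i k) x
       + (\<Sum>m\<in>UNIV. christoffel G m j k x * christoffel G l i m x
                  - christoffel G m i k x * christoffel G l j m x))
     * u $ i * v $ j * w $ k)"

definition sectional_curvature ::
    "(real^'n \<Rightarrow> real^'n^'n) \<Rightarrow> real^'n \<Rightarrow> real^'n \<Rightarrow> real^'n::finite \<Rightarrow> real" where
  "sectional_curvature G x u v =
     ip (G x) (curvature G x u v v) u /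
     (ip (G x) u u * ip (G x) v v - (ip (G x) u v)\<^sup>2)"


section \<open>Curves and fields along curves\<close>

text \<open>
  A field \<open>V\<close> along \<open>\<gamma>\<close> is given by its components \<open>V c t\<close> in the charts \<open>c\<close>; only those \<open>t\<close>
  with \<open>\<gamma> t \<in> cdom c\<close> are meaningful.
\<close>

type_synonym ('m, 'n) field_along = "('m, 'n) chart \<Rightarrow> real \<Rightarrow> real^'n"

definition smooth_curve ::
    "('m::topological_space, 'n::finite) chart set \<Rightarrow> real set \<Rightarrow> (real \<Rightarrow> 'm) \<Rightarrow> bool" where
  "smooth_curve A I \<gamma> \<longleftrightarrow> continuous_on I \<gamma> \<and>
     (\<forall>c\<in>A. smooth_on {t\<in>I. \<gamma> t \<in> cdom c} (cmap c \<circ> \<gamma>))"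

definition smooth_field_along ::
    "('m, 'n::finite) chart set \<Rightarrow> real set \<Rightarrow> (real \<Rightarrow> 'm) \<Rightarrow> ('m, 'n) field_along \<Rightarrow> bool" where
  "smooth_field_along A I \<gamma> V \<longleftrightarrow>
     (\<forall>c\<in>A. smooth_on {t\<in>I. \<gamma> t \<in> cdom c} (V c)) \<and>
     (\<forall>c\<in>A. \<forall>d\<in>A. \<forall>t\<in>I. \<gamma> t \<in> cdom c \<inter> cdom d \<longrightarrow>
        V d t = transition_deriv c d (\<gamma> t) (V c t))"

definition velocity :: "real set \<Rightarrow> (real \<Rightarrow> 'm) \<Rightarrow> ('m, 'n::finite) field_along" where
  "velocity I \<gamma> = (\<lambda>c t. vector_derivative (cmap c \<circ> \<gamma>) (at t within I))"

definition cov_deriv ::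
    "(('m, 'n) chart \<Rightarrow> real^'n \<Rightarrow> real^'n^'n) \<Rightarrow> real set \<Rightarrow> (real \<Rightarrow> 'm) \<Rightarrow>
     ('m, 'n::finite) field_along \<Rightarrow> ('m, 'n) field_along" where
  "cov_deriv g I \<gamma> V = (\<lambda>c t. vector_derivative (V c) (at t within I) +
     (\<chi> l. \<Sum>i\<in>UNIV. \<Sum>j\<in>UNIV.
        christoffel (g c) l i j (cmap c (\<gamma> t)) * velocity I \<gamma> c t $ i * V c t $ j))"

definition iter_cov_velocity ::
    "(('m, 'n) chart \<Rightarrow> real^'n \<Rightarrow> real^'n^'n) \<Rightarrow> real set \<Rightarrow> (real \<Rightarrow> 'm) \<Rightarrow>
     nat \<Rightarrow> ('m, 'n::finite) field_along" where
  "iter_cov_velocity g I \<gamma> j = (cov_deriv g I \<gamma> ^^ j) (velocity I \<gamma>)"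

definition geodesic ::
    "('m::topological_space, 'n::finite) chart set \<Rightarrow> (('m, 'n) chart \<Rightarrow> real^'n \<Rightarrow> real^'n^'n) \<Rightarrow>
     real set \<Rightarrow> (real \<Rightarrow> 'm) \<Rightarrow> bool" where
  "geodesic A g I \<gamma> \<longleftrightarrow> smooth_curve A I \<gamma> \<and>
     (\<forall>c\<in>A. \<forall>t\<in>I. \<gamma> t \<in> cdom c \<longrightarrow> cov_deriv g I \<gamma> (velocity I \<gamma>) c t = 0)"

text \<open>
  For \<open>l < r - 1\<close> all the truncated subtractions below are exact; for \<open>r = 1\<close> the sum is empty.
\<close>

definition r_harmonic ::
    "('m::topological_space, 'n::finite) chart set \<Rightarrow> (('m, 'n) chart \<Rightarrow> real^'n \<Rightarrow> real^'n^'n) \<Rightarrow>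
     nat \<Rightarrow> real set \<Rightarrow> (real \<Rightarrow> 'm) \<Rightarrow> bool" where
  "r_harmonic A g r I \<gamma> \<longleftrightarrow> smooth_curve A I \<gamma> \<and>
     (\<forall>c\<in>A. \<forall>t\<in>I. \<gamma> t \<in> cdom c \<longrightarrow>
        iter_cov_velocity g I \<gamma> (2*r - 1) c t +
        (\<Sum>l<r - 1. (-1)^l *\<^sub>R
           curvature (g c) (cmap c (\<gamma> t))
             (iter_cov_velocity g I \<gamma> (2*r - 3 - l) c t)
             (iter_cov_velocity g I \<gamma> l c t)
             (velocity I \<gamma> c t)) = 0)"

definition arclength_parametrized ::
    "('m, 'n::finite) chart set \<Rightarrow> (('m, 'n) chart \<Rightarrow> real^'n \<Rightarrow> real^'n^'n) \<Rightarrow>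
     real set \<Rightarrow> (real \<Rightarrow> 'm) \<Rightarrow> bool" where
  "arclength_parametrized A g I \<gamma> \<longleftrightarrow> (\<forall>c\<in>A. \<forall>t\<in>I. \<gamma> t \<in> cdom c \<longrightarrow>
     ip (g c (cmap c (\<gamma> t))) (velocity I \<gamma> c t) (velocity I \<gamma> c t) = 1)"

text \<open>
  \<open>T = velocity I \<gamma>\<close>, \<open>F2\<close>, \<open>F3\<close> is an orthonormal Frenet frame along \<open>\<gamma>\<close>
  with geodesic curvature \<open>k\<close> and torsion \<open>\<tau>\<close>.
\<close>

definition frenet_frame ::
    "('m, 3) chart set \<Rightarrow> (('m, 3) chart \<Rightarrow> real^3 \<Rightarrow> real^3^3) \<Rightarrow> real set \<Rightarrow> (real \<Rightarrow> 'm) \<Rightarrow>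
     ('m, 3) field_along \<Rightarrow> ('m, 3) field_along \<Rightarrow> (real \<Rightarrow> real) \<Rightarrow> (real \<Rightarrow> real) \<Rightarrow> bool" where
  "frenet_frame A g I \<gamma> F2 F3 k \<tau> \<longleftrightarrow>
     smooth_field_along A I \<gamma> F2 \<and> smooth_field_along A I \<gamma> F3 \<and>
     (\<forall>c\<in>A. \<forall>t\<in>I. \<gamma> t \<in> cdom c \<longrightarrow>
       (let T = velocity I \<gamma>; h = ip (g c (cmap c (\<gamma> t))) in
          h (T c t) (T c t) = 1 \<and> h (F2 c t) (F2 c t) = 1 \<and> h (F3 c t) (F3 c t) = 1 \<and>
          h (T c t) (F2 c t) = 0 \<and> h (T c t) (F3 c t) = 0 \<and> h (F2 c t) (F3 c t) = 0 \<and>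
          cov_deriv g I \<gamma> T c t = k t *\<^sub>R F2 c t \<and>
          cov_deriv g I \<gamma> F2 c t = - k t *\<^sub>R T c t + \<tau> t *\<^sub>R F3 c t \<and>
          cov_deriv g I \<gamma> F3 c t = - \<tau> t *\<^sub>R F2 c t))"


section \<open>Space forms\<close>

text \<open>
  A space form is a connected, (geodesically) complete Riemannian manifold of constant sectional
  curvature.
\<close>

locale space_form = riemannian_manifold A g
  for A :: "('m::{t2_space, second_countable_topology}, 'n::finite) chart set" and g +
  fixes K :: real
  assumes connected_manifold: "connected (UNIV :: 'm set)"
    and complete_manifold: "c \<in> A \<Longrightarrow> p \<in> cdom c \<Longrightarrow>
      \<exists>\<gamma>. geodesic A g UNIV \<gamma> \<and> \<gamma> 0 = p \<and> velocity UNIV \<gamma> c 0 = v"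
    and constant_curvature: "c \<in> A \<Longrightarrow> x \<in> cmap c ` cdom c \<Longrightarrow>
      u \<noteq> v \<Longrightarrow> independent {u, v} \<Longrightarrow> sectional_curvature (g c) x u v = K"

end

theory Submission
  imports Defs
begin

text \<open>
  Put \<open>q = k\<^sup>2 + \<tau>\<^sup>2\<close>.  For constant \<open>k\<close> and \<open>\<tau>\<close> the Frenet equations give
  \<open>\<nabla>\<^sup>3T = - q \<nabla>T\<close>, so the odd derivatives of \<open>T\<close> are \<open>(-q)\<^sup>m k F\<^sub>2\<close> and the even ones
  \<open>(-q)\<^sup>m k (-k T + \<tau> F\<^sub>3)\<close>.  Take the inner product of the \<open>r\<close>-harmonic equation with \<open>F\<^sub>2\<close> and
  multiply by \<open>(-1)\<^bsup>r-1\<^esup> k\<close>: the leading term becomes \<open>q\<^bsup>r-1\<^esup> k\<^sup>2\<close>, while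
  the curvature terms become \<open>- K\<close> times \<open>q\<^bsup>r-2\<^esup> k\<^sup>2\<close> for \<open>l = 0\<close> and
  \<open>q\<^bsup>r-3\<^esup> k\<^sup>4\<close> for \<open>l > 0\<close>.  With \<open>K \<le> 0\<close> all terms are nonnegative, so \<open>k = 0\<close>.

  The \<open>F\<^sub>2\<close>-component of \<open>R(F\<^sub>2, v)w\<close> follows from the sectional curvature by polarization, which needs
  the symmetries of the curvature tensor.
\<close>

section \<open>Symmetry of second derivatives\<close>

text \<open>Functions that agree on \<open>S\<close> have the same derivatives within
  \<open>S\<close>, and \<open>frechet_derivative\<close> is a choice among these, so the two
  choices coincide even at points without a derivative.\<close>

lemma C_k_on_cong:
  assumes "\<And>x. x \<in> S \<Longrightarrow> f x = g x"
  shows "C_k_on n S f \<longleftrightarrow> C_k_on n S g"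
  using assms
proof (induction n arbitrary: f g)
  case 0
  then show ?case
    by (simp cong: continuous_on_cong)
next
  case (Suc n)
  have hd: "(f has_derivative D) (at x within S) \<longleftrightarrow> (g has_derivative D) (at x within S)"
    if "x \<in> S" for x D
    using has_derivative_transform[OF that, of f g] has_derivative_transform[OF that, of g f]
      Suc.prems by metis
  have "C_k_on n S (\<lambda>x. frechet_derivative f (at x within S) v) \<longleftrightarrow>
        C_k_on n S (\<lambda>x. frechet_derivative g (at x within S) v)" for v
    by (rule Suc.IH) (simp add: frechet_derivative_def hd)
  moreover have "f differentiable (at x within S) \<longleftrightarrow> g differentiable (at x within S)"
    if "x \<in> S" for x
    using hd[OF that] by (simp add: differentiable_def)
  ultimately show ?case
    by simp
qed

text \<open>On open sets this takes the place of the recursive equation, hence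
  \<open>del: C_k_on.simps\<close> where it is applied; derivatives then appear as
  \<open>at x\<close>.\<close>

lemma C_k_on_Suc_open:
  assumes "open S"
  shows "C_k_on (Suc n) S f \<longleftrightarrow>
    (\<forall>x\<in>S. f differentiable (at x)) \<and> (\<forall>v. C_k_on n S (\<lambda>x. frechet_derivative f (at x) v))"
proof -
  have eq: "at x within S = at x" if "x \<in> S" for x
    using that assms by (rule at_within_open)
  have "C_k_on n S (\<lambda>x. frechet_derivative f (at x within S) v) \<longleftrightarrow>
        C_k_on n S (\<lambda>x. frechet_derivative f (at x) v)" for v
    by (rule C_k_on_cong) (simp add: eq)
  then show ?thesis
    by (simp add: eq)
qed

text \<open>A bounded linear map commutes with differentiation, so the induction hypothesis applies
  to each directional derivative of \<open>f\<close>. It serves to pass from the matrix-valued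
  metric to its entries.\<close>

lemma C_k_on_bounded_linear:
  assumes "open S" and L: "bounded_linear L" and "C_k_on n S f"
  shows "C_k_on n S (\<lambda>x. L (f x))"
  using assms(3)
proof (induction n arbitrary: f)
  case 0
  then show ?case
    using L by (simp add: bounded_linear.continuous_on)
next
  case (Suc n)
  have f: "f differentiable (at x)" if "x \<in> S" for x
    using Suc.prems that by (simp add: C_k_on_Suc_open[OF \<open>open S\<close>] del: C_k_on.simps)
  have hd: "((\<lambda>y. L (f y)) has_derivative (\<lambda>v. L (frechet_derivative f (at x) v))) (at x)"
    if "x \<in> S" for x
    using f[OF that] L by (auto simp: frechet_derivative_works bounded_linear.has_derivative)
  have "C_k_on n S (\<lambda>x. frechet_derivative (\<lambda>y. L (f y)) (at x) v)" for v
  proof -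
    have "C_k_on n S (\<lambda>x. L (frechet_derivative f (at x) v))"
      using Suc.prems by (intro Suc.IH) (simp add: C_k_on_Suc_open[OF \<open>open S\<close>] del: C_k_on.simps)
    moreover have "L (frechet_derivative f (at x) v) = frechet_derivative (\<lambda>y. L (f y)) (at x) v"
      if "x \<in> S" for x
      using fun_cong[OF frechet_derivative_at[OF hd[OF that]]] .
    ultimately show ?thesis
      by (rule C_k_on_cong[THEN iffD1, rotated])
  qed
  moreover have "(\<lambda>y. L (f y)) differentiable (at x)" if "x \<in> S" for x
    using hd[OF that] by (auto simp: differentiable_def)
  ultimately show ?case
    by (simp add: C_k_on_Suc_open[OF \<open>open S\<close>] del: C_k_on.simps)
qed

lemma mvt_line:
  fixes f :: "'a::real_normed_vector \<Rightarrow> real"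
  assumes "0 < h" and d: "\<And>s. 0 \<le> s \<Longrightarrow> s \<le> h \<Longrightarrow> f differentiable (at (p + s *\<^sub>R u))"
  shows "\<exists>s. 0 < s \<and> s < h \<and>
    f (p + h *\<^sub>R u) - f p = h * frechet_derivative f (at (p + s *\<^sub>R u)) u"
proof -
  have "((\<lambda>s. f (p + s *\<^sub>R u)) has_real_derivative frechet_derivative f (at (p + s *\<^sub>R u)) u) (at s)"
    if "0 \<le> s" "s \<le> h" for s
  proof -
    let ?D = "frechet_derivative f (at (p + s *\<^sub>R u))"
    have D: "(f has_derivative ?D) (at (p + s *\<^sub>R u))"
      using d[OF that] by (simp add: frechet_derivative_works)
    have "((\<lambda>s. f (p + s *\<^sub>R u)) has_derivative (\<lambda>z. ?D (z *\<^sub>R u))) (at s)"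
      by (rule has_derivative_compose[where f = "\<lambda>s. p + s *\<^sub>R u" and g = f])
        (auto intro!: derivative_eq_intros D)
    moreover have "?D (z *\<^sub>R u) = ?D u * z" for z
      using linear_scale[OF has_derivative_linear[OF D]] by simp
    ultimately show ?thesis
      by (simp add: has_field_derivative_def)
  qed
  from MVT2[OF \<open>0 < h\<close> this] show ?thesis
    by auto
qed

text \<open>
  Since the left-hand side is symmetric in \<open>u\<close> and \<open>v\<close>, letting \<open>h \<rightarrow> 0\<close> yields the symmetry of the
  second derivative.
\<close>

lemma mixed_difference:
  fixes f :: "'a::real_normed_vector \<Rightarrow> real"
  assumes "open S" and f: "C_k_on 2 S f" and "0 < h"
    and S: "\<And>s t. 0 \<le> s \<Longrightarrow> s \<le> h \<Longrightarrow> 0 \<le> t \<Longrightarrow> t \<le> h \<Longrightarrow> x + s *\<^sub>R u + t *\<^sub>R v \<in> S"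
  shows "\<exists>s t. 0 < s \<and> s < h \<and> 0 < t \<and> t < h \<and>
    f (x + h *\<^sub>R u + h *\<^sub>R v) - f (x + h *\<^sub>R u) - f (x + h *\<^sub>R v) + f x =
    h * h * frechet_derivative (\<lambda>y. frechet_derivative f (at y) u) (at (x + s *\<^sub>R u + t *\<^sub>R v)) v"
proof -
  have d: "f differentiable (at y)" "(\<lambda>y. frechet_derivative f (at y) u) differentiable (at y)"
    if "y \<in> S" for y
    using f that by (simp_all add: C_k_on_Suc_open[OF \<open>open S\<close>] eval_nat_numeral del: C_k_on.simps)
  \<comment> \<open>\<open>F\<close> is the difference of \<open>f\<close> in direction
    \<open>v\<close>. The mean value theorem for \<open>F\<close> in direction \<open>u\<close>
    yields \<open>s\<close>; applied to the \<open>u\<close>-derivative of \<open>f\<close> in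
    direction \<open>v\<close> it then yields \<open>t\<close>.\<close>
  define F where "F y = f (y + h *\<^sub>R v) - f y" for y
  have D: "(F has_derivative (\<lambda>z. frechet_derivative f (at (x + s *\<^sub>R u + h *\<^sub>R v)) z -
      frechet_derivative f (at (x + s *\<^sub>R u)) z)) (at (x + s *\<^sub>R u))"
    if "0 \<le> s" "s \<le> h" for s
  proof -
    have "((\<lambda>y. f (y + h *\<^sub>R v)) has_derivative frechet_derivative f (at (x + s *\<^sub>R u + h *\<^sub>R v)))
        (at (x + s *\<^sub>R u))"
      by (rule has_derivative_compose[where f = "\<lambda>y. y + h *\<^sub>R v" and f' = "\<lambda>z. z" and g = f])
        (use d(1)[OF S[OF that, of h]] \<open>0 < h\<close> in
          \<open>auto intro!: derivative_eq_intros simp: frechet_derivative_works\<close>)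
    moreover have "(f has_derivative frechet_derivative f (at (x + s *\<^sub>R u))) (at (x + s *\<^sub>R u))"
      using d(1)[OF S[OF that, of 0]] \<open>0 < h\<close> by (simp add: frechet_derivative_works)
    ultimately show ?thesis
      unfolding F_def by (rule has_derivative_diff)
  qed
  obtain s where s: "0 < s" "s < h"
    and Fs: "F (x + h *\<^sub>R u) - F x = h * frechet_derivative F (at (x + s *\<^sub>R u)) u"
    using mvt_line[OF \<open>0 < h\<close>, of F x u] D by (auto simp: differentiable_def)
  obtain t where t: "0 < t" "t < h"
    and ft: "frechet_derivative f (at (x + s *\<^sub>R u + h *\<^sub>R v)) u -
        frechet_derivative f (at (x + s *\<^sub>R u)) u =
        h * frechet_derivative (\<lambda>y. frechet_derivative f (at y) u) (at (x + s *\<^sub>R u + t *\<^sub>R v)) v"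
    using mvt_line[OF \<open>0 < h\<close>, of "\<lambda>y. frechet_derivative f (at y) u" "x + s *\<^sub>R u" v] d(2)[OF S] s
    by auto
  have "frechet_derivative F (at (x + s *\<^sub>R u)) u =
    frechet_derivative f (at (x + s *\<^sub>R u + h *\<^sub>R v)) u - frechet_derivative f (at (x + s *\<^sub>R u)) u"
    using fun_cong[OF frechet_derivative_at[OF D[of s]], of u] s by simp
  then have "F (x + h *\<^sub>R u) - F x = h * h *
      frechet_derivative (\<lambda>y. frechet_derivative f (at y) u) (at (x + s *\<^sub>R u + t *\<^sub>R v)) v"
    using Fs ft by simp
  then show ?thesis
    using s t unfolding F_def by (intro exI[of _ s] exI[of _ t]) (simp add: algebra_simps)
qed

lemma second_derivative_symmetric:
  fixes f :: "'a::real_normed_vector \<Rightarrow> real"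
  assumes "open S" and f: "C_k_on 2 S f" and "x \<in> S"
  shows "frechet_derivative (\<lambda>y. frechet_derivative f (at y) u) (at x) v =
    frechet_derivative (\<lambda>y. frechet_derivative f (at y) v) (at x) u"
proof -
  define D where "D u v y = frechet_derivative (\<lambda>y. frechet_derivative f (at y) u) (at y) v" for u v y
  have cont: "isCont (D u v) x" for u v
  proof -
    have "continuous_on S (D u v)"
      using f by (simp add: C_k_on_Suc_open[OF \<open>open S\<close>] eval_nat_numeral D_def[abs_def]
        del: C_k_on.simps(2))
    then show ?thesis
      using assms by (simp add: continuous_on_eq_continuous_at)
  qed
  have less: "\<bar>D u v x - D v u x\<bar> < e" if "e > 0" for e
  proof -
    obtain d1 where d1: "d1 > 0" "\<And>y. dist y x < d1 \<Longrightarrow> dist (D u v y) (D u v x) < e / 2"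
      using cont[of u v] \<open>e > 0\<close> by (metis continuous_at_eps_delta half_gt_zero)
    obtain d2 where d2: "d2 > 0" "\<And>y. dist y x < d2 \<Longrightarrow> dist (D v u y) (D v u x) < e / 2"
      using cont[of v u] \<open>e > 0\<close> by (metis continuous_at_eps_delta half_gt_zero)
    obtain d3 where d3: "d3 > 0" "\<And>y. dist y x < d3 \<Longrightarrow> y \<in> S"
      using assms by (metis open_dist)
    define d where "d = min d1 (min d2 d3)"
    have "d > 0"
      using d1 d2 d3 by (simp add: d_def)
    \<comment> \<open>The parallelogram spanned by \<open>h u\<close> and \<open>h v\<close> stays
      within \<open>d / 2\<close> of \<open>x\<close>; the summand 1 keeps the denominator positive
      when \<open>u\<close> and \<open>v\<close> vanish.\<close>
    define h where "h = d / (2 * (norm u + norm v + 1))"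
    have "h > 0"
      using \<open>d > 0\<close> by (auto simp: h_def intro!: divide_pos_pos add_nonneg_pos)
    have small: "dist (x + s *\<^sub>R u + t *\<^sub>R v) x < d" if "0 \<le> s" "s \<le> h" "0 \<le> t" "t \<le> h" for s t
    proof -
      have "dist (x + s *\<^sub>R u + t *\<^sub>R v) x = norm (s *\<^sub>R u + t *\<^sub>R v)"
        by (simp add: dist_norm algebra_simps)
      also have "\<dots> \<le> s * norm u + t * norm v"
        using norm_triangle_ineq[of "s *\<^sub>R u" "t *\<^sub>R v"] that by simp
      also have "\<dots> \<le> h * norm u + h * norm v"
        using that by (intro add_mono mult_right_mono) auto
      also have "\<dots> \<le> h * (norm u + norm v + 1)"
        using \<open>h > 0\<close> by (simp add: algebra_simps)
      also have "\<dots> = d / 2"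
        unfolding h_def using add_nonneg_pos[of "norm u + norm v" 1]
        by (simp add: field_simps)
      finally show ?thesis
        using \<open>d > 0\<close> by simp
    qed
    have small': "dist (x + s *\<^sub>R v + t *\<^sub>R u) x < d" if "0 \<le> s" "s \<le> h" "0 \<le> t" "t \<le> h" for s t
      using small[of t s] that by (simp add: algebra_simps)
    have S: "y \<in> S" if "dist y x < d" for y
      using d3 that by (simp add: d_def)
    have Suv: "x + s *\<^sub>R u + t *\<^sub>R v \<in> S" "x + s *\<^sub>R v + t *\<^sub>R u \<in> S"
      if "0 \<le> s" "s \<le> h" "0 \<le> t" "t \<le> h" for s t
      using small[OF that] small'[OF that] by (simp_all add: S)
    obtain s t where st: "0 < s" "s < h" "0 < t" "t < h"
      "f (x + h *\<^sub>R u + h *\<^sub>R v) - f (x + h *\<^sub>R u) - f (x + h *\<^sub>R v) + f x =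
        h * h * D u v (x + s *\<^sub>R u + t *\<^sub>R v)"
      using mixed_difference[OF \<open>open S\<close> f \<open>h > 0\<close> Suv(1)] unfolding D_def by blast
    obtain s' t' where st': "0 < s'" "s' < h" "0 < t'" "t' < h"
      "f (x + h *\<^sub>R v + h *\<^sub>R u) - f (x + h *\<^sub>R v) - f (x + h *\<^sub>R u) + f x =
        h * h * D v u (x + s' *\<^sub>R v + t' *\<^sub>R u)"
      using mixed_difference[OF \<open>open S\<close> f \<open>h > 0\<close> Suv(2)] unfolding D_def by blast
    \<comment> \<open>The mixed difference is unchanged when \<open>u\<close> and \<open>v\<close>
      are interchanged, so the two second derivatives agree exactly at two possibly different points
      near \<open>x\<close>.\<close>
    have "h * h * D u v (x + s *\<^sub>R u + t *\<^sub>R v) = h * h * D v u (x + s' *\<^sub>R v + t' *\<^sub>R u)"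
      unfolding st(5)[symmetric] st'(5)[symmetric] by (simp add: algebra_simps)
    then have "D u v (x + s *\<^sub>R u + t *\<^sub>R v) = D v u (x + s' *\<^sub>R v + t' *\<^sub>R u)"
      using \<open>h > 0\<close> by simp
    moreover have "dist (D u v (x + s *\<^sub>R u + t *\<^sub>R v)) (D u v x) < e / 2"
      using small[of s t] st by (intro d1) (simp add: d_def)
    moreover have "dist (D v u (x + s' *\<^sub>R v + t' *\<^sub>R u)) (D v u x) < e / 2"
      using small'[of s' t'] st' by (intro d2) (simp add: d_def)
    ultimately show ?thesis
      unfolding dist_real_def by linarith
  qed
  have "D u v x = D v u x"
  proof (rule ccontr)
    assume "D u v x \<noteq> D v u x"
    then have "0 < \<bar>D u v x - D v u x\<bar>"
      by linarith
    from less[OF this] show False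
      by (rule less_irrefl[THEN notE])
  qed
  then show ?thesis
    by (simp add: D_def)
qed


section \<open>The curvature tensor in coordinates\<close>

lemma pd_cong:
  assumes "open S" "x \<in> S" "\<And>y. y \<in> S \<Longrightarrow> f y = g y"
  shows "pd i f x = pd i g x"
proof -
  have "(f has_derivative D) (at x) \<longleftrightarrow> (g has_derivative D) (at x)" for D
    using has_derivative_transform_within_open[OF _ assms(1,2), of f D UNIV g]
      has_derivative_transform_within_open[OF _ assms(1,2), of g D UNIV f] assms(3) by metis
  then show ?thesis
    by (simp add: pd_def frechet_derivative_def)
qed

lemma pd_add:
  assumes "f differentiable (at x)" "g differentiable (at x)"
  shows "pd i (\<lambda>y. f y + g y) x = pd i f x + pd i g x"
proof -
  have "((\<lambda>y. f y + g y) has_derivative (\<lambda>h. frechet_derivative f (at x) h +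
      frechet_derivative g (at x) h)) (at x)"
    using assms unfolding frechet_derivative_works by (rule has_derivative_add)
  from fun_cong[OF frechet_derivative_at[OF this], of "axis i 1"] show ?thesis
    unfolding pd_def by linarith
qed

lemma pd_mult:
  assumes "f differentiable (at x)" "g differentiable (at x)"
  shows "pd i (\<lambda>y. f y * g y) x = pd i f x * g x + f x * pd i g x"
proof -
  have "((\<lambda>y. f y * g y) has_derivative (\<lambda>h. f x * frechet_derivative g (at x) h +
      frechet_derivative f (at x) h * g x)) (at x)"
    using assms unfolding frechet_derivative_works by (rule has_derivative_mult)
  from fun_cong[OF frechet_derivative_at[OF this], of "axis i 1"] show ?thesis
    unfolding pd_def by linarith
qed

lemma pd_sum:
  assumes "\<And>k. k \<in> J \<Longrightarrow> f k differentiable (at x)"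
  shows "pd i (\<lambda>y. \<Sum>k\<in>J. f k y) x = (\<Sum>k\<in>J. pd i (f k) x)"
proof -
  have "((\<lambda>y. \<Sum>k\<in>J. f k y) has_derivative (\<lambda>h. \<Sum>k\<in>J. frechet_derivative (f k) (at x) h)) (at x)"
    using assms unfolding frechet_derivative_works by (rule has_derivative_sum)
  from fun_cong[OF frechet_derivative_at[OF this], of "axis i 1"] show ?thesis
    unfolding pd_def by linarith
qed

section \<open>Differentiability of determinants and inverse matrices\<close>

lemma differentiable_prod:
  fixes f :: "'i \<Rightarrow> 'a::real_normed_vector \<Rightarrow> real"
  assumes "\<And>i. i \<in> J \<Longrightarrow> f i differentiable (at x within S)"
  shows "(\<lambda>x. \<Prod>i\<in>J. f i x) differentiable (at x within S)"
proof -
  obtain f' where f': "\<And>i. i \<in> J \<Longrightarrow> (f i has_derivative f' i) (at x within S)"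
    using assms unfolding differentiable_def by metis
  show ?thesis
    unfolding differentiable_def by (rule exI, rule has_derivative_prod, erule f')
qed

lemma differentiable_det:
  fixes M :: "'a::real_normed_vector \<Rightarrow> real^'n^'n"
  assumes "\<And>i j. (\<lambda>x. M x $ i $ j) differentiable (at x)"
  shows "(\<lambda>x. det (M x)) differentiable (at x)"
  unfolding det_def using assms
  by (intro differentiable_sum differentiable_mult differentiable_const differentiable_prod ballI)
    (auto simp: finite_permutations)

lemma matrix_inv_right:
  fixes M :: "real^'n^'n"
  assumes "invertible M"
  shows "M ** matrix_inv M = mat 1"
  unfolding matrix_inv_def
  using someI_ex[OF assms[unfolded invertible_def]] by simp

text \<open>Cramer's rule shows that the entries of the inverse matrix are differentiable.\<close>

lemma matrix_inv_cramer:
  fixes M :: "real^'n^'n"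
  assumes "invertible M"
  shows "matrix_inv M $ l $ m =
    det (\<chi> i j. if j = l then axis m 1 $ i else M $ i $ j) / det M"
proof -
  \<comment> \<open>Column \<open>m\<close> of the inverse solves the linear system with right-hand
    side \<open>axis m 1\<close>.\<close>
  have "M *v column m (matrix_inv M) = column m (mat 1)"
    by (simp add: matrix_inv_right[OF assms, symmetric] column_def matrix_vector_mult_def
      matrix_matrix_mult_def)
  also have "column m (mat 1) = (axis m 1 :: real^'n)"
    by (auto simp: column_def mat_def axis_def vec_eq_iff)
  finally have "column m (matrix_inv M) =
      (\<chi> k. det (\<chi> i j. if j = k then axis m 1 $ i else M $ i $ j) / det M)"
    using assms by (subst (asm) cramer) (auto simp: invertible_det_nz)
  then show ?thesis
    by (simp add: column_def vec_eq_iff)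
qed

section \<open>Metric and Christoffel symbols in a single chart\<close>

locale coordinate_metric =
  fixes S :: "(real^'n::finite) set" and G :: "real^'n \<Rightarrow> real^'n^'n"
  assumes open_S: "open S"
    and smooth_G: "smooth_on S G"
    and sym_G: "y \<in> S \<Longrightarrow> transpose (G y) = G y"
    and pos_G: "y \<in> S \<Longrightarrow> u \<noteq> 0 \<Longrightarrow> ip (G y) u u > 0"
begin

abbreviation gc :: "'n \<Rightarrow> 'n \<Rightarrow> real^'n \<Rightarrow> real" where
  "gc i j \<equiv> \<lambda>y. G y $ i $ j"

abbreviation \<Gamma> :: "'n \<Rightarrow> 'n \<Rightarrow> 'n \<Rightarrow> real^'n \<Rightarrow> real" where
  "\<Gamma> \<equiv> christoffel G"

lemma gc_sym: "y \<in> S \<Longrightarrow> G y $ i $ j = G y $ j $ i"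
  using sym_G[of y] by (metis transpose_def vec_lambda_beta)

lemma pd_gc_sym: "y \<in> S \<Longrightarrow> pd k (gc i j) y = pd k (gc j i) y"
  by (rule pd_cong[OF open_S]) (auto simp: gc_sym)

lemma C_k_gc: "C_k_on n S (gc i j)"
proof -
  have "bounded_linear (\<lambda>M::real^'n^'n. M $ i $ j)"
    by (intro bounded_linear_compose[OF bounded_linear_vec_nth] bounded_linear_vec_nth)
  from C_k_on_bounded_linear[OF open_S this] smooth_G show ?thesis
    by (auto simp: smooth_on_def)
qed

lemma differentiable_gc: "y \<in> S \<Longrightarrow> gc i j differentiable (at y)"
  using C_k_gc[of "Suc 0" i j] by (simp add: C_k_on_Suc_open[OF open_S] del: C_k_on.simps)

lemma differentiable_pd_gc: "y \<in> S \<Longrightarrow> pd k (gc i j) differentiable (at y)"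
  using C_k_gc[of "Suc (Suc 0)" i j]
  by (simp add: C_k_on_Suc_open[OF open_S] pd_def[abs_def] del: C_k_on.simps)

lemma pd_pd_gc: "y \<in> S \<Longrightarrow> pd k (pd l (gc i j)) y = pd l (pd k (gc i j)) y"
  using second_derivative_symmetric[OF open_S C_k_gc] by (simp add: pd_def[abs_def])

text \<open>A nonzero kernel vector would have length zero, against positive definiteness.\<close>

lemma invertible_G:
  assumes "y \<in> S"
  shows "invertible (G y)"
proof -
  have "u = 0" if "G y *v u = 0" for u
  proof (rule ccontr)
    have "ip (G y) u u = u \<bullet> (G y *v u)"
      by (simp add: ip_def inner_vec_def matrix_vector_mult_def sum_distrib_left mult_ac)
    also have "\<dots> = 0"
      using that by simp
    finally have "ip (G y) u u = 0" .
    moreover assume "u \<noteq> 0"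
    ultimately show False
      using pos_G[OF assms] by fastforce
  qed
  then show ?thesis
    by (simp add: invertible_left_inverse matrix_left_invertible_ker)
qed

lemma christoffel_sym:
  assumes "y \<in> S"
  shows "\<Gamma> l i j y = \<Gamma> l j i y"
  using assms by (simp add: christoffel_def pd_gc_sym[of y _ i j] add.commute)

text \<open>The metric cancels its inverse in the definition and leaves the Christoffel symbols of
  the first kind.\<close>

lemma lower_christoffel:
  assumes "y \<in> S"
  shows "(\<Sum>l\<in>UNIV. G y $ k $ l * \<Gamma> l i j y) =
    (pd i (gc j k) y + pd j (gc i k) y - pd k (gc i j) y) / 2"
proof -
  define c where "c m = pd i (gc j m) y + pd j (gc i m) y - pd m (gc i j) y" for m
  have inv: "(\<Sum>l\<in>UNIV. G y $ k $ l * matrix_inv (G y) $ l $ m) = (if k = m then 1 else 0)" for m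
  proof -
    have "(G y ** matrix_inv (G y)) $ k $ m = mat 1 $ k $ m"
      using matrix_inv_right[OF invertible_G[OF assms]] by simp
    then show ?thesis
      by (simp add: matrix_matrix_mult_def mat_def)
  qed
  have "(\<Sum>l\<in>UNIV. G y $ k $ l * \<Gamma> l i j y) =
      (\<Sum>l\<in>UNIV. \<Sum>m\<in>UNIV. 1/2 * (G y $ k $ l * matrix_inv (G y) $ l $ m) * c m)"
    by (simp add: christoffel_def c_def sum_distrib_left mult_ac)
  also have "\<dots> = (\<Sum>m\<in>UNIV. \<Sum>l\<in>UNIV. 1/2 * (G y $ k $ l * matrix_inv (G y) $ l $ m) * c m)"
    by (rule sum.swap)
  also have "\<dots> = (\<Sum>m\<in>UNIV. 1/2 * (\<Sum>l\<in>UNIV. G y $ k $ l * matrix_inv (G y) $ l $ m) * c m)"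
    by (simp add: sum_distrib_left sum_distrib_right)
  also have "\<dots> = c k / 2"
    by (simp add: inv if_distrib if_distribR cong: if_cong)
  finally show ?thesis
    by (simp add: c_def)
qed

text \<open>The metric is parallel: in the sum of the two first-kind symbols the derivatives in
  directions \<open>j\<close> and \<open>k\<close> cancel, and the two halves of the derivative in
  direction \<open>i\<close> add up.\<close>

lemma metric_compatible:
  assumes "y \<in> S"
  shows "pd i (gc j k) y =
    (\<Sum>l\<in>UNIV. \<Gamma> l i j y * G y $ l $ k) + (\<Sum>l\<in>UNIV. \<Gamma> l i k y * G y $ l $ j)"
proof -
  have eq: "(\<Sum>l\<in>UNIV. \<Gamma> l i j y * G y $ l $ k) = (\<Sum>l\<in>UNIV. G y $ k $ l * \<Gamma> l i j y)" for j k
    by (simp add: mult.commute gc_sym[OF assms, of k])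
  show ?thesis
    unfolding eq lower_christoffel[OF assms]
    by (simp add: pd_gc_sym[OF assms, of _ k j] pd_gc_sym[OF assms, of _ k i] pd_gc_sym[OF assms, of _ j i]
      field_simps)
qed

lemma differentiable_christoffel:
  assumes "y \<in> S"
  shows "\<Gamma> l i j differentiable (at y)"
proof -
  \<comment> \<open>Cramer's expression agrees with \<open>matrix_inv\<close> where the metric is
    invertible, in particular on \<open>S\<close>; differentiability is therefore transferred within
    the open set \<open>S\<close>.\<close>
  define inv where "inv l m = (\<lambda>x. det (\<chi> i j. if j = l then axis m 1 $ i else G x $ i $ j) / det (G x))" for l m
  define c where "c m = (\<lambda>x. pd i (gc j m) x + pd j (gc i m) x - pd m (gc i j) x)" for m
  have "inv l k differentiable (at y)" for k
  proof -
    have "(\<lambda>x. det (\<chi> i j. if j = l then axis k 1 $ i else G x $ i $ j)) differentiable (at y)"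
    proof (rule differentiable_det)
      fix i j
      show "(\<lambda>x. (\<chi> i j. if j = l then axis k 1 $ i else G x $ i $ j) $ i $ j) differentiable at y"
        using differentiable_gc[OF assms] by (cases "j = l") auto
    qed
    moreover have "(\<lambda>x. det (G x)) differentiable (at y)"
      by (rule differentiable_det) (rule differentiable_gc[OF assms])
    ultimately show ?thesis
      unfolding inv_def using invertible_G[OF assms]
      by (intro differentiable_divide) (auto simp: invertible_det_nz)
  qed
  moreover have "c k differentiable (at y)" for k
    unfolding c_def
    using differentiable_pd_gc[OF assms] by (intro differentiable_add differentiable_diff) auto
  ultimately have "(\<lambda>x. (1/2) * (\<Sum>k\<in>UNIV. inv l k x * c k x)) differentiable (at y)"
    by (intro differentiable_mult differentiable_sum) auto
  then obtain D where D: "((\<lambda>x. (1/2) * (\<Sum>k\<in>UNIV. inv l k x * c k x)) has_derivative D) (at y)"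
    by (auto simp: differentiable_def)
  have "(\<Gamma> l i j has_derivative D) (at y)"
    by (rule has_derivative_transform_within_open[OF D open_S assms])
      (simp add: christoffel_def inv_def c_def matrix_inv_cramer[OF invertible_G])
  then show ?thesis
    by (auto simp: differentiable_def)
qed

section \<open>Symmetries of the curvature components\<close>

definition riem :: "real^'n \<Rightarrow> 'n \<Rightarrow> 'n \<Rightarrow> 'n \<Rightarrow> 'n \<Rightarrow> real" where
  "riem x l i j k = pd i (\<Gamma> l j k) x - pd j (\<Gamma> l i k) x +
     (\<Sum>m\<in>UNIV. \<Gamma> m j k x * \<Gamma> l i m x - \<Gamma> m i k x * \<Gamma> l j m x)"

lemma curvature_riem:
  "curvature G x u v w $ l =
    (\<Sum>i\<in>UNIV. \<Sum>j\<in>UNIV. \<Sum>k\<in>UNIV. riem x l i j k * u $ i * v $ j * w $ k)"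
  by (simp add: curvature_def riem_def)

text \<open>The connection is torsion-free: since Christoffel symbols are symmetric in their lower
  indices, the derivative terms and the quadratic terms cancel in pairs over the cyclic sum.\<close>

lemma riem_bianchi:
  assumes "x \<in> S"
  shows "riem x l i j k + riem x l j k i + riem x l k i j = 0"
proof -
  have "pd a (\<Gamma> l b c) x = pd a (\<Gamma> l c b) x" for a b c
    by (rule pd_cong[OF open_S assms]) (rule christoffel_sym)
  note pd = this[of i k j] this[of j k i] this[of k j i]
  have g: "\<Gamma> m b c x = \<Gamma> m c b x" for m b c
    by (rule christoffel_sym[OF assms])
  show ?thesis
    unfolding riem_def sum_subtractf
    by (simp add: pd g[of _ k j] g[of _ k i] g[of _ j i])
qed

text \<open>Metric compatibility is differentiated once more. In terms of coordinate fields
  \<open>e\<close>, \<open>B i j k p\<close> is the inner product of nabla_i nabla_j e_k with e_p,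
  and \<open>C i j k p\<close> that of nabla_j e_k with nabla_i e_p; the claim is the product rule
  for the inner product of e_k and e_p.\<close>

lemma pd_pd_gc_christoffel:
  assumes "x \<in> S"
  defines "B \<equiv> \<lambda>i j k p. \<Sum>l\<in>UNIV. (pd i (\<Gamma> l j k) x + (\<Sum>m\<in>UNIV. \<Gamma> m j k x * \<Gamma> l i m x)) * G x $ l $ p"
    and "C \<equiv> \<lambda>i j k p. \<Sum>l\<in>UNIV. \<Sum>m\<in>UNIV. \<Gamma> l j k x * \<Gamma> m i p x * G x $ l $ m"
  shows "pd i (pd j (gc k p)) x = B i j k p + B i j p k + C i j k p + C i j p k"
proof -
  have half: "(\<Sum>l\<in>UNIV. pd i (\<Gamma> l j k) x * G x $ l $ p + \<Gamma> l j k x * pd i (gc l p) x) =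
      B i j k p + C i j k p" for k p
  proof -
    have "(\<Sum>l\<in>UNIV. \<Gamma> l j k x * (\<Sum>m\<in>UNIV. \<Gamma> m i l x * G x $ m $ p)) =
        (\<Sum>l\<in>UNIV. \<Sum>m\<in>UNIV. \<Gamma> l j k x * \<Gamma> m i l x * G x $ m $ p)"
      by (simp add: sum_distrib_left mult.assoc)
    also have "\<dots> = (\<Sum>l\<in>UNIV. (\<Sum>m\<in>UNIV. \<Gamma> m j k x * \<Gamma> l i m x) * G x $ l $ p)"
      by (subst sum.swap) (simp add: sum_distrib_right)
    finally have 1: "(\<Sum>l\<in>UNIV. \<Gamma> l j k x * (\<Sum>m\<in>UNIV. \<Gamma> m i l x * G x $ m $ p)) = \<dots>" .
    have 2: "(\<Sum>l\<in>UNIV. \<Gamma> l j k x * (\<Sum>m\<in>UNIV. \<Gamma> m i p x * G x $ m $ l)) = C i j k p"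
      by (simp add: C_def sum_distrib_left mult.assoc gc_sym[OF assms(1)])
    show ?thesis
      unfolding metric_compatible[OF assms(1), of i] distrib_left sum.distrib 1 2
      by (simp add: B_def distrib_right sum.distrib)
  qed
  have d: "(\<lambda>y. \<Gamma> l j k y * G y $ l $ p) differentiable (at x)" for l k p
    using differentiable_christoffel differentiable_gc assms(1) by (intro differentiable_mult)
  have one: "pd i (\<lambda>y. \<Sum>l\<in>UNIV. \<Gamma> l j k y * G y $ l $ p) x = B i j k p + C i j k p" for k p
    unfolding half[symmetric]
    by (subst pd_sum[OF d])
      (simp add: pd_mult[OF differentiable_christoffel differentiable_gc] assms(1))
  have "pd i (pd j (gc k p)) x =
      pd i (\<lambda>y. (\<Sum>l\<in>UNIV. \<Gamma> l j k y * G y $ l $ p) + (\<Sum>l\<in>UNIV. \<Gamma> l j p y * G y $ l $ k)) x"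
    by (rule pd_cong[OF open_S assms(1)]) (rule metric_compatible)
  also have "\<dots> = (B i j k p + C i j k p) + (B i j p k + C i j p k)"
    by (subst pd_add) (auto intro!: differentiable_sum d simp: one)
  finally show ?thesis
    by simp
qed

text \<open>
  Antisymmetrize in \<open>i\<close> and \<open>j\<close>: the second derivatives of the metric cancel, and so do the terms \<open>C\<close>.
\<close>

lemma riem_skew:
  assumes "x \<in> S"
  shows "(\<Sum>l\<in>UNIV. riem x l i j k * G x $ l $ p) + (\<Sum>l\<in>UNIV. riem x l i j p * G x $ l $ k) = 0"
proof -
  define B where "B i j k p = (\<Sum>l\<in>UNIV. (pd i (\<Gamma> l j k) x + (\<Sum>m\<in>UNIV. \<Gamma> m j k x * \<Gamma> l i m x)) * G x $ l $ p)"
    for i j k p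
  define C where "C i j k p = (\<Sum>l\<in>UNIV. \<Sum>m\<in>UNIV. \<Gamma> l j k x * \<Gamma> m i p x * G x $ l $ m)" for i j k p
  \<comment> \<open>Hence the sum of \<open>C i j k p\<close> and \<open>C i j p k\<close> is
    symmetric in \<open>i\<close> and \<open>j\<close>.\<close>
  have C: "C i j k p = C j i p k" for i j k p
    unfolding C_def by (subst sum.swap) (simp add: mult_ac gc_sym[OF assms])
  have B: "(\<Sum>l\<in>UNIV. riem x l i j k * G x $ l $ p) = B i j k p - B j i k p" for k p
    unfolding B_def riem_def sum_subtractf[symmetric]
    by (rule sum.cong) (simp_all add: sum_subtractf algebra_simps)
  have "B i j k p + B i j p k + C i j k p + C i j p k = B j i k p + B j i p k + C j i k p + C j i p k"
    using pd_pd_gc_christoffel[OF assms, of i j k p] pd_pd_gc_christoffel[OF assms, of j i k p]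
      pd_pd_gc[OF assms, of i j k p] by (simp add: B_def C_def)
  then show ?thesis
    using C[of i j k p] C[of i j p k] unfolding B by simp
qed

end

section \<open>Curvature identities for vectors\<close>

lemma ip_add_left: "ip M (u + v) w = ip M u w + ip M v w"
  by (simp add: ip_def algebra_simps sum.distrib)

lemma ip_add_right: "ip M u (v + w) = ip M u v + ip M u w"
  by (simp add: ip_def algebra_simps sum.distrib)

lemma ip_scaleR_left: "ip M (a *\<^sub>R u) w = a * ip M u w"
  by (simp add: ip_def mult_ac sum_distrib_left)

lemma ip_scaleR_right: "ip M u (a *\<^sub>R w) = a * ip M u w"
  by (simp add: ip_def mult_ac sum_distrib_left)

lemma ip_zero_left: "ip M 0 w = 0"
  by (simp add: ip_def)

lemma ip_minus_left: "ip M (- u) w = - ip M u w"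
  by (simp add: ip_def sum_negf)

lemma ip_sum_left: "ip M (\<Sum>i\<in>J. f i) w = (\<Sum>i\<in>J. ip M (f i) w)"
  by (induction J rule: infinite_finite_induct) (simp_all add: ip_zero_left ip_add_left)

context coordinate_metric
begin

lemma ip_commute: "x \<in> S \<Longrightarrow> ip (G x) u v = ip (G x) v u"
  unfolding ip_def by (subst sum.swap) (simp add: mult_ac gc_sym[of x])

lemma curvature_add:
  "curvature G x (u + u') v w = curvature G x u v w + curvature G x u' v w"
  "curvature G x u (v + v') w = curvature G x u v w + curvature G x u v' w"
  "curvature G x u v (w + w') = curvature G x u v w + curvature G x u v w'"
  by (simp_all add: vec_eq_iff curvature_riem distrib_left distrib_right sum.distrib)

lemma curvature_scaleR:
  "curvature G x (a *\<^sub>R u) v w = a *\<^sub>R curvature G x u v w"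
  "curvature G x u (a *\<^sub>R v) w = a *\<^sub>R curvature G x u v w"
  "curvature G x u v (a *\<^sub>R w) = a *\<^sub>R curvature G x u v w"
  by (simp_all add: vec_eq_iff curvature_riem sum_distrib_left mult_ac)

lemma curvature_swap: "curvature G x u v w = - curvature G x v u w"
proof -
  have riem: "riem x l j i k * v $ j * u $ i * w $ k = - (riem x l i j k * u $ i * v $ j * w $ k)"
    for l i j k
    by (simp add: riem_def sum_subtractf algebra_simps)
  have "curvature G x v u w $ l = - curvature G x u v w $ l" for l
    unfolding curvature_riem by (subst sum.swap) (simp only: riem sum_negf)
  then show ?thesis
    by (simp add: vec_eq_iff)
qed

lemma curvature_bianchi:
  assumes "x \<in> S"
  shows "curvature G x u v w + curvature G x v w u + curvature G x w u v = 0"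
proof -
  \<comment> \<open>The summation indices are renamed so that all three terms carry the common
    factor \<open>u $ i * v $ j * w $ k\<close> and the identity for components applies under the
    sums.\<close>
  have 1: "curvature G x v w u $ l =
      (\<Sum>i\<in>UNIV. \<Sum>j\<in>UNIV. \<Sum>k\<in>UNIV. riem x l j k i * u $ i * v $ j * w $ k)" for l
  proof -
    have "curvature G x v w u $ l =
        (\<Sum>j\<in>UNIV. \<Sum>i\<in>UNIV. \<Sum>k\<in>UNIV. riem x l j k i * v $ j * w $ k * u $ i)"
      unfolding curvature_riem by (intro sum.cong refl sum.swap)
    then show ?thesis
      by (subst sum.swap) (simp add: mult_ac)
  qed
  have 2: "curvature G x w u v $ l =
      (\<Sum>i\<in>UNIV. \<Sum>j\<in>UNIV. \<Sum>k\<in>UNIV. riem x l k i j * u $ i * v $ j * w $ k)" for l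
  proof -
    have "curvature G x w u v $ l =
        (\<Sum>i\<in>UNIV. \<Sum>k\<in>UNIV. \<Sum>j\<in>UNIV. riem x l k i j * w $ k * u $ i * v $ j)"
      unfolding curvature_riem by (rule sum.swap)
    also have "\<dots> = (\<Sum>i\<in>UNIV. \<Sum>j\<in>UNIV. \<Sum>k\<in>UNIV. riem x l k i j * w $ k * u $ i * v $ j)"
      by (intro sum.cong refl sum.swap)
    finally show ?thesis
      by (simp add: mult_ac)
  qed
  have "(curvature G x u v w + curvature G x v w u + curvature G x w u v) $ l =
      (\<Sum>i\<in>UNIV. \<Sum>j\<in>UNIV. \<Sum>k\<in>UNIV.
        (riem x l i j k + riem x l j k i + riem x l k i j) * u $ i * v $ j * w $ k)" for l
    unfolding vector_add_component 1 2 by (simp add: curvature_riem distrib_right sum.distrib)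
  then show ?thesis
    by (simp add: riem_bianchi[OF assms] vec_eq_iff)
qed

lemma curvature_skew:
  assumes "x \<in> S"
  shows "ip (G x) (curvature G x u v w) z = - ip (G x) (curvature G x u v z) w"
proof -
  \<comment> \<open>\<open>M\<close> is the curvature with its upper index lowered; it is skew in
    the last two indices by \<open>riem_skew\<close>.\<close>
  define M where "M i j k p = (\<Sum>l\<in>UNIV. riem x l i j k * G x $ l $ p)" for i j k p
  have M: "M i j k p = - M i j p k" for i j k p
    using riem_skew[OF assms, of i j k p] by (simp add: M_def)
  have ip: "ip (G x) (curvature G x u v w) z =
      (\<Sum>i\<in>UNIV. \<Sum>j\<in>UNIV. \<Sum>k\<in>UNIV. \<Sum>p\<in>UNIV. u $ i * v $ j * (M i j k p * w $ k * z $ p))" for w z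
  proof -
    have "curvature G x u v w = (\<Sum>i\<in>UNIV. \<Sum>j\<in>UNIV. \<Sum>k\<in>UNIV.
        (u $ i * v $ j * w $ k) *\<^sub>R (\<chi> l. riem x l i j k))"
      by (simp add: vec_eq_iff curvature_riem mult_ac)
    moreover have "ip (G x) (\<chi> l. riem x l i j k) z = (\<Sum>p\<in>UNIV. M i j k p * z $ p)" for i j k
      unfolding ip_def M_def by (subst sum.swap) (simp add: sum_distrib_left mult_ac)
    ultimately show ?thesis
      by (simp add: ip_sum_left ip_scaleR_left sum_distrib_left mult_ac)
  qed
  have "(\<Sum>k\<in>UNIV. \<Sum>p\<in>UNIV. u $ i * v $ j * (M i j k p * w $ k * z $ p)) =
      - (\<Sum>k\<in>UNIV. \<Sum>p\<in>UNIV. u $ i * v $ j * (M i j k p * z $ k * w $ p))" for i j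
  proof -
    have "u $ i * v $ j * (M i j k p * w $ k * z $ p) = - (u $ i * v $ j * (M i j p k * z $ p * w $ k))"
      for k p
      by (subst M) simp
    then show ?thesis
      by (subst sum.swap) (simp only: sum_negf)
  qed
  then show ?thesis
    unfolding ip by (simp add: sum_negf)
qed

text \<open>The bilinear form \<open>B\<close> is symmetric, and for \<open>v\<close> orthogonal to
  the unit vector \<open>e\<close> the denominator of the sectional curvature is the squared length
  of \<open>v\<close>. So \<open>B\<close> and \<open>K\<close> times the metric have the same
  diagonal on the complement of \<open>e\<close>, and polarization identifies them there.\<close>

lemma constant_curvature_orthogonal:
  assumes "x \<in> S"
    and K: "\<And>u v. u \<noteq> v \<Longrightarrow> independent {u, v} \<Longrightarrow> sectional_curvature G x u v = K"
    and e: "ip (G x) e e = 1" and "ip (G x) e v = 0" "ip (G x) e w = 0"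
  shows "ip (G x) (curvature G x e v w) e = K * ip (G x) v w"
proof -
  define B where "B v w = ip (G x) (curvature G x e v w) e" for v w
  have diag: "B v v = K * ip (G x) v v" if "ip (G x) e v = 0" for v
  proof (cases "v = 0")
    case True
    then show ?thesis
      using curvature_scaleR(2)[of x e 0 0 v] by (simp add: B_def ip_zero_left)
  next
    case False
    then have v: "ip (G x) v v > 0"
      by (rule pos_G[OF assms(1)])
    \<comment> \<open>A multiple of \<open>v\<close> orthogonal to \<open>v\<close> vanishes,
      whereas \<open>e\<close> has length 1.\<close>
    have "e \<notin> span {v}"
    proof
      assume "e \<in> span {v}"
      then obtain a where a: "e = a *\<^sub>R v"
        by (auto simp: span_singleton)
      then have "a * ip (G x) v v = 0"
        using that by (simp add: ip_scaleR_left)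
      then show False
        using e a v by (simp add: ip_zero_left)
    qed
    then have "e \<noteq> v" "independent {e, v}"
      using False span_base[of v "{v}"] by (auto simp: independent_insert)
    from K[OF this] show ?thesis
      using v e that by (simp add: sectional_curvature_def B_def divide_eq_eq)
  qed
  \<comment> \<open>By the Bianchi identity, \<open>B v w\<close> and \<open>B w v\<close> differ by
    the \<open>e\<close>-component of R(v, w)e up to sign, and this component is zero by
    skewness.\<close>
  have "curvature G x e v w + curvature G x v w e = curvature G x e w v"
    using curvature_bianchi[OF assms(1), of e v w] curvature_swap[of x w e v]
    by (simp add: algebra_simps)
  moreover have "ip (G x) (curvature G x v w e) e = 0"
    using curvature_skew[OF assms(1), of v w e e] by simp
  ultimately have sym: "B v w = B w v"
    unfolding B_def by (metis ip_add_left add.right_neutral)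
  have "B (v + w) (v + w) = B v v + B w w + 2 * B v w"
    using sym by (simp add: B_def curvature_add ip_add_left)
  moreover have "ip (G x) (v + w) (v + w) = ip (G x) v v + ip (G x) w w + 2 * ip (G x) v w"
    using ip_commute[OF assms(1), of w v] by (simp add: ip_add_left ip_add_right)
  moreover have "ip (G x) e (v + w) = 0"
    using assms by (simp add: ip_add_right)
  ultimately have "2 * B v w = 2 * (K * ip (G x) v w)"
    using diag[of v] diag[of w] diag[of "v + w"] assms by (simp add: algebra_simps)
  then show ?thesis
    by (simp add: B_def)
qed

end

text \<open>The curvature identities are pointwise, so the calculus of one chart at a time
  suffices.\<close>

lemma (in riemannian_manifold) coordinate_metric_chart:
  assumes "c \<in> A"
  shows "coordinate_metric (cmap c ` cdom c) (g c)"
  using assms open_image smooth_metric metric_sym metric_pos by unfold_locales auto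


section \<open>Derivatives along Frenet curves\<close>

text \<open>Smoothness is formulated on the parameters that \<open>\<gamma>\<close> maps into a
  chart, but \<open>velocity\<close> and \<open>cov_deriv\<close> differentiate within
  \<open>I\<close>. The two filters agree because these parameters form a relatively open subset of
  \<open>I\<close>.\<close>

lemma at_within_preimage:
  assumes "continuous_on I \<gamma>" "open U" "t \<in> I" "\<gamma> t \<in> U"
  shows "at t within {s\<in>I. \<gamma> s \<in> U} = at t within I"
proof -
  have "openin (top_of_set I) (I \<inter> \<gamma> -` U)"
    using assms by (intro continuous_openin_preimage_gen)
  then obtain W where W: "open W" "I \<inter> \<gamma> -` U = I \<inter> W"
    by (auto simp: openin_open)
  show ?thesis
    by (rule at_within_nhd[of t W]) (use W assms in auto)
qed

lemma has_vector_derivative_frechet: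
  assumes "f differentiable F"
  shows "(f has_vector_derivative frechet_derivative f F 1) F"
proof -
  have D: "(f has_derivative frechet_derivative f F) F"
    using assms by (simp add: frechet_derivative_works)
  have "x *\<^sub>R frechet_derivative f F 1 = frechet_derivative f F x" for x
    using linear_scale[OF has_derivative_linear[OF D], of x 1] by simp
  then have "(\<lambda>x. x *\<^sub>R frechet_derivative f F 1) = frechet_derivative f F"
    by (rule ext)
  then show ?thesis
    using D by (simp only: has_vector_derivative_def)
qed

lemma smooth_on_differentiable:
  assumes "smooth_on J f" "t \<in> J"
  shows "f differentiable (at t within J)"
  using assms(1)[unfolded smooth_on_def, rule_format, of "Suc 0"] assms(2) by simp

lemma differentiable_cong_within:
  assumes "f differentiable (at t within J)" "t \<in> J" "\<And>s. s \<in> J \<Longrightarrow> g s = f s"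
  shows "g differentiable (at t within J)"
  using assms unfolding differentiable_def by (metis has_derivative_transform)

text \<open>\<open>smooth_on\<close> speaks of \<open>frechet_derivative\<close> and
  \<open>velocity\<close> of \<open>vector_derivative\<close>. Derivatives are unique on nontrivial
  filters, so the latter is the former evaluated at 1.\<close>

lemma smooth_on_vector_derivative_differentiable:
  assumes "smooth_on J f" and nt: "\<And>s. s \<in> J \<Longrightarrow> at s within J \<noteq> bot" and "t \<in> J"
  shows "(\<lambda>s. vector_derivative f (at s within J)) differentiable (at t within J)"
proof -
  have eq: "vector_derivative f (at s within J) = frechet_derivative f (at s within J) 1" if "s \<in> J" for s
    using has_vector_derivative_frechet[OF smooth_on_differentiable[OF assms(1) that]] nt[OF that]
    by (rule vector_derivative_within[rotated])
  have "(\<lambda>s. frechet_derivative f (at s within J) 1) differentiable (at t within J)"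
    using assms(1)[unfolded smooth_on_def, rule_format, of "Suc (Suc 0)"] \<open>t \<in> J\<close> by simp
  then show ?thesis
    using \<open>t \<in> J\<close> eq by (rule differentiable_cong_within)
qed

text \<open>A nonempty interior rules out a one-point interval, and a connected set with more than
  one point has no isolated points. This includes the end points of \<open>I\<close>.\<close>

lemma at_within_interval_nontrivial:
  fixes I :: "real set"
  assumes "is_interval I" "interior I \<noteq> {}" "t \<in> I"
  shows "at t within I \<noteq> bot"
proof -
  have "I \<noteq> {x}" for x
    using assms(2) by auto
  then have "t islimpt I"
    using assms by (intro connected_imp_perfect) (simp_all add: is_interval_connected)
  then show ?thesis
    by (simp add: trivial_limit_within)
qed

lemma velocity_differentiable:
  assumes "smooth_curve A I \<gamma>" "is_interval I" "interior I \<noteq> {}"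
    and "c \<in> A" "open (cdom c)" "t \<in> I" "\<gamma> t \<in> cdom c"
  shows "velocity I \<gamma> c differentiable (at t within I)"
proof -
  define J where "J = {s\<in>I. \<gamma> s \<in> cdom c}"
  have J: "at s within J = at s within I" if "s \<in> J" for s
    using at_within_preimage[of I \<gamma> "cdom c" s] assms that by (auto simp: J_def smooth_curve_def)
  have "t \<in> J"
    using assms by (simp add: J_def)
  have nt: "at s within J \<noteq> bot" if "s \<in> J" for s
    using at_within_interval_nontrivial[OF assms(2,3), of s] that by (simp add: J) (simp add: J_def)
  have "(\<lambda>s. vector_derivative (cmap c \<circ> \<gamma>) (at s within J)) differentiable (at t within J)"
    using assms(1,4) nt \<open>t \<in> J\<close>
    by (intro smooth_on_vector_derivative_differentiable) (auto simp: smooth_curve_def J_def)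
  then have "velocity I \<gamma> c differentiable (at t within J)"
    using \<open>t \<in> J\<close> by (rule differentiable_cong_within) (simp add: velocity_def J)
  then show ?thesis
    by (simp add: J[OF \<open>t \<in> J\<close>])
qed

text \<open>Linearity of the covariant derivative for constant coefficients. The fields need to be
  related only where the curve lies in the chart, since these parameters form a neighbourhood of
  \<open>t\<close> in \<open>I\<close>.\<close>

lemma cov_deriv_combination:
  assumes "continuous_on I \<gamma>" "open (cdom c)" "t \<in> I" "\<gamma> t \<in> cdom c" and nt: "at t within I \<noteq> bot"
    and V: "\<And>s. s \<in> I \<Longrightarrow> \<gamma> s \<in> cdom c \<Longrightarrow> V c s = a *\<^sub>R X c s + b *\<^sub>R Y c s"
    and X: "X c differentiable (at t within I)" and Y: "Y c differentiable (at t within I)"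
  shows "cov_deriv g I \<gamma> V c t = a *\<^sub>R cov_deriv g I \<gamma> X c t + b *\<^sub>R cov_deriv g I \<gamma> Y c t"
proof -
  define J where "J = {s\<in>I. \<gamma> s \<in> cdom c}"
  have J: "at t within J = at t within I" and "t \<in> J"
    using at_within_preimage[of I \<gamma> "cdom c" t] assms by (auto simp: J_def)
  have vd: "(f has_vector_derivative vector_derivative f (at t within I)) (at t within I)"
    if "f differentiable (at t within I)" for f :: "real \<Rightarrow> real^'b"
    using that by (simp add: vector_derivative_works)
  have "((\<lambda>s. a *\<^sub>R X c s + b *\<^sub>R Y c s) has_vector_derivative
      a *\<^sub>R vector_derivative (X c) (at t within I) + b *\<^sub>R vector_derivative (Y c) (at t within I))
      (at t within J)"
    unfolding J using vd[OF X] vd[OF Y] by (auto intro!: derivative_eq_intros)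
  then have "(V c has_vector_derivative
      a *\<^sub>R vector_derivative (X c) (at t within I) + b *\<^sub>R vector_derivative (Y c) (at t within I))
      (at t within J)"
    by (rule has_vector_derivative_transform[OF \<open>t \<in> J\<close>, rotated]) (simp add: V J_def)
  then have "vector_derivative (V c) (at t within I) =
      a *\<^sub>R vector_derivative (X c) (at t within I) + b *\<^sub>R vector_derivative (Y c) (at t within I)"
    unfolding J by (rule vector_derivative_within[OF nt])
  then show ?thesis
    using V[OF assms(3,4)]
    by (simp add: cov_deriv_def vec_eq_iff algebra_simps sum.distrib sum_distrib_left)
qed

lemma iter_cov_velocity_simps:
  "iter_cov_velocity g I \<gamma> 0 = velocity I \<gamma>"
  "iter_cov_velocity g I \<gamma> (Suc j) = cov_deriv g I \<gamma> (iter_cov_velocity g I \<gamma> j)"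
  by (simp_all add: iter_cov_velocity_def)

text \<open>The tangent vector itself, at index 0, does not follow the even pattern, which therefore
  starts at index 2.\<close>

lemma iter_cov_velocity_frenet:
  fixes A :: "('m::topological_space, 3) chart set"
  assumes curve: "smooth_curve A I \<gamma>" and I: "is_interval I" "interior I \<noteq> {}"
    and frenet: "frenet_frame A g I \<gamma> F2 F3 k \<tau>"
    and k: "\<And>t. t \<in> I \<Longrightarrow> k t = \<kappa>" and \<tau>: "\<And>t. t \<in> I \<Longrightarrow> \<tau> t = \<theta>"
    and c: "c \<in> A" "open (cdom c)" and t: "t \<in> I" "\<gamma> t \<in> cdom c"
  defines "q \<equiv> \<kappa>\<^sup>2 + \<theta>\<^sup>2"
  shows "iter_cov_velocity g I \<gamma> (2 * m + 1) c t = ((- q) ^ m * \<kappa>) *\<^sub>R F2 c t"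
    and "iter_cov_velocity g I \<gamma> (2 * m + 2) c t =
      ((- q) ^ m * \<kappa>) *\<^sub>R (- \<kappa> *\<^sub>R velocity I \<gamma> c t + \<theta> *\<^sub>R F3 c t)"
proof -
  have D: "velocity I \<gamma> c differentiable (at t within I)" "F2 c differentiable (at t within I)"
    "F3 c differentiable (at t within I)" if "t \<in> I" "\<gamma> t \<in> cdom c" for t
  proof -
    have "at t within {s\<in>I. \<gamma> s \<in> cdom c} = at t within I"
      using curve that c by (intro at_within_preimage) (auto simp: smooth_curve_def)
    moreover have "smooth_on {s\<in>I. \<gamma> s \<in> cdom c} (F2 c)" "smooth_on {s\<in>I. \<gamma> s \<in> cdom c} (F3 c)"
      using frenet c by (auto simp: frenet_frame_def smooth_field_along_def)
    ultimately show "F2 c differentiable (at t within I)" "F3 c differentiable (at t within I)"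
      using smooth_on_differentiable[of "{s\<in>I. \<gamma> s \<in> cdom c}" _ t] that by auto
  qed (rule velocity_differentiable[OF curve I c that])
  have F: "cov_deriv g I \<gamma> (velocity I \<gamma>) c t = \<kappa> *\<^sub>R F2 c t"
    "cov_deriv g I \<gamma> F2 c t = - \<kappa> *\<^sub>R velocity I \<gamma> c t + \<theta> *\<^sub>R F3 c t"
    "cov_deriv g I \<gamma> F3 c t = - \<theta> *\<^sub>R F2 c t" if "t \<in> I" "\<gamma> t \<in> cdom c" for t
    using frenet c(1) that k[OF that(1)] \<tau>[OF that(1)] unfolding frenet_frame_def Let_def by blast+
  have comb: "cov_deriv g I \<gamma> V c t = a *\<^sub>R cov_deriv g I \<gamma> X c t + b *\<^sub>R cov_deriv g I \<gamma> Y c t"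
    if "t \<in> I" "\<gamma> t \<in> cdom c"
      "\<And>s. s \<in> I \<Longrightarrow> \<gamma> s \<in> cdom c \<Longrightarrow> V c s = a *\<^sub>R X c s + b *\<^sub>R Y c s"
      "X c differentiable (at t within I)" "Y c differentiable (at t within I)" for V X Y a b t
    using curve c at_within_interval_nontrivial[OF I] that
    by (intro cov_deriv_combination) (auto simp: smooth_curve_def)
  have even: "cov_deriv g I \<gamma> V c t = a *\<^sub>R (- \<kappa> *\<^sub>R velocity I \<gamma> c t + \<theta> *\<^sub>R F3 c t)"
    if "\<And>s. s \<in> I \<Longrightarrow> \<gamma> s \<in> cdom c \<Longrightarrow> V c s = a *\<^sub>R F2 c s" "t \<in> I" "\<gamma> t \<in> cdom c" for V a t
    using comb[of t V a F2 0 F2] D F that by simp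
  \<comment> \<open>The derivatives of T and F3 are both multiples of F2, and the coefficients
    combine to \<open>- a * (\<kappa>\<^sup>2 + \<theta>\<^sup>2)\<close>.\<close>
  have odd: "cov_deriv g I \<gamma> V c t = (- q * a) *\<^sub>R F2 c t"
    if "\<And>s. s \<in> I \<Longrightarrow> \<gamma> s \<in> cdom c \<Longrightarrow> V c s = a *\<^sub>R (- \<kappa> *\<^sub>R velocity I \<gamma> c s + \<theta> *\<^sub>R F3 c s)"
      "t \<in> I" "\<gamma> t \<in> cdom c" for V a t
  proof -
    have "cov_deriv g I \<gamma> V c t = (- a * \<kappa>) *\<^sub>R (\<kappa> *\<^sub>R F2 c t) + (a * \<theta>) *\<^sub>R (- \<theta> *\<^sub>R F2 c t)"
      using comb[of t V "- a * \<kappa>" "velocity I \<gamma>" "a * \<theta>" F3] D F that by (simp add: algebra_simps)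
    then show ?thesis
      by (simp add: q_def scaleR_left_distrib[symmetric] power2_eq_square algebra_simps)
  qed
  \<comment> \<open>The claim is quantified over all parameters in the chart before the induction,
    because differentiating the induction hypothesis needs it near \<open>t\<close> and not only at
    \<open>t\<close>.\<close>
  have all: "\<forall>t. t \<in> I \<longrightarrow> \<gamma> t \<in> cdom c \<longrightarrow>
    iter_cov_velocity g I \<gamma> (2 * m + 1) c t = ((- q) ^ m * \<kappa>) *\<^sub>R F2 c t"
  proof (induction m)
    case 0
    then show ?case
      by (simp add: iter_cov_velocity_simps F)
  next
    case (Suc m)
    have "iter_cov_velocity g I \<gamma> (Suc (2 * m + 1)) c t =
        ((- q) ^ m * \<kappa>) *\<^sub>R (- \<kappa> *\<^sub>R velocity I \<gamma> c t + \<theta> *\<^sub>R F3 c t)" if "t \<in> I" "\<gamma> t \<in> cdom c" for t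
      unfolding iter_cov_velocity_simps(2) by (rule even) (use Suc that in auto)
    then have "iter_cov_velocity g I \<gamma> (Suc (Suc (2 * m + 1))) c t =
        (- q * ((- q) ^ m * \<kappa>)) *\<^sub>R F2 c t" if "t \<in> I" "\<gamma> t \<in> cdom c" for t
      unfolding iter_cov_velocity_simps(2)[of _ _ _ "Suc (2 * m + 1)"] using that
      by (intro odd) auto
    then show ?case
      by simp
  qed
  then show "iter_cov_velocity g I \<gamma> (2 * m + 1) c t = ((- q) ^ m * \<kappa>) *\<^sub>R F2 c t"
    using t by simp
  have "iter_cov_velocity g I \<gamma> (Suc (2 * m + 1)) c t =
      ((- q) ^ m * \<kappa>) *\<^sub>R (- \<kappa> *\<^sub>R velocity I \<gamma> c t + \<theta> *\<^sub>R F3 c t)"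
    unfolding iter_cov_velocity_simps(2) by (rule even) (use all t in auto)
  then show "iter_cov_velocity g I \<gamma> (2 * m + 2) c t =
      ((- q) ^ m * \<kappa>) *\<^sub>R (- \<kappa> *\<^sub>R velocity I \<gamma> c t + \<theta> *\<^sub>R F3 c t)"
    by simp
qed

section \<open>The F2-component of the r-harmonic equation\<close>

lemma geodesic_curvature_zero:
  fixes A :: "('m::{t2_space, second_countable_topology}, 3) chart set"
  assumes "r \<ge> 1" and "space_form A g K" and "K \<le> 0"
    and I: "is_interval I" "interior I \<noteq> {}"
    and harmonic: "r_harmonic A g r I \<gamma>"
    and frenet: "frenet_frame A g I \<gamma> F2 F3 k \<tau>"
    and k: "\<And>t. t \<in> I \<Longrightarrow> k t = \<kappa>" and \<tau>: "\<And>t. t \<in> I \<Longrightarrow> \<tau> t = \<theta>"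
  shows "\<kappa> = 0"
proof (rule ccontr)
  assume "\<kappa> \<noteq> 0"
  interpret space_form A g K
    by fact
  obtain t where t: "t \<in> I"
    using I(2) interior_subset by blast
  obtain c where c: "c \<in> A" "\<gamma> t \<in> cdom c"
    using cover by blast
  interpret coordinate_metric "cmap c ` cdom c" "g c"
    by (rule coordinate_metric_chart[OF c(1)])
  define x where "x = cmap c (\<gamma> t)"
  define h where "h = ip (g c x)"
  define R where "R = curvature (g c) x"
  define D where "D j = iter_cov_velocity g I \<gamma> j c t" for j
  define T where "T = velocity I \<gamma> c t"
  define q where "q = \<kappa>\<^sup>2 + \<theta>\<^sup>2"
  have x: "x \<in> cmap c ` cdom c"
    using c by (simp add: x_def)
  have "q > 0"
    using \<open>\<kappa> \<noteq> 0\<close> by (simp add: q_def add_pos_nonneg)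
  have D: "D 0 = T" "D (2 * m + 1) = ((- q) ^ m * \<kappa>) *\<^sub>R F2 c t"
    "D (2 * m + 2) = ((- q) ^ m * \<kappa>) *\<^sub>R (- \<kappa> *\<^sub>R T + \<theta> *\<^sub>R F3 c t)" for m
    using iter_cov_velocity_frenet[OF _ I frenet k \<tau> c(1) open_dom[OF c(1)] t c(2)] harmonic
    by (auto simp: D_def T_def q_def iter_cov_velocity_simps r_harmonic_def)
  have frame: "h T T = 1" "h (F2 c t) (F2 c t) = 1" "h (F2 c t) T = 0" "h (F2 c t) (F3 c t) = 0"
    "h (F3 c t) T = 0"
    using frenet c t ip_commute[OF x, of "F2 c t" T] ip_commute[OF x, of "F3 c t" T]
    by (auto simp: frenet_frame_def Let_def h_def T_def x_def)
  have RK: "h (R (F2 c t) v w) (F2 c t) = K * h v w" if "h (F2 c t) v = 0" "h (F2 c t) w = 0" for v w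
    unfolding h_def R_def
    using constant_curvature_orthogonal[OF x constant_curvature[OF c(1) x]] frame that by (simp add: h_def)
  \<comment> \<open>F3 is orthogonal to T, so only the T-part of the second derivative
    contributes.\<close>
  have Rm: "h (R (F2 c t) (- \<kappa> *\<^sub>R T + \<theta> *\<^sub>R F3 c t) T) (F2 c t) = - \<kappa> * K"
    using RK[of "- \<kappa> *\<^sub>R T + \<theta> *\<^sub>R F3 c t" T] frame
    unfolding h_def ip_add_left ip_add_right ip_scaleR_left ip_scaleR_right by simp
  have Rs: "R u v w = - R v u w" for u v w
    unfolding R_def by (rule curvature_swap)
  have Rc: "R (a *\<^sub>R u) v w = a *\<^sub>R R u v w" "R u (a *\<^sub>R v) w = a *\<^sub>R R u v w" for a u v w
    by (simp_all add: R_def curvature_scaleR)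
  have hc: "h (a *\<^sub>R u) v = a * h u v" "h (- u) v = - h u v" "h (u + v) w = h u w + h v w" for a u v w
    by (simp_all add: h_def ip_scaleR_left ip_minus_left ip_add_left)
  have sgn: "(- 1) ^ n * (- q) ^ n = q ^ n" for n
    by (simp add: power_mult_distrib[symmetric])
  define F2_part where "F2_part l = h ((- 1) ^ l *\<^sub>R R (D (2 * r - 3 - l)) (D l) T) (F2 c t)" for l
  \<comment> \<open>For \<open>l = 0\<close> the second argument of the curvature is T, of length 1,
    which gives a lower power of \<open>\<kappa>\<close> than for \<open>l > 0\<close>; the cases
    are therefore separate.\<close>
  have nonneg: "(- 1) ^ (r - 1) * \<kappa> * F2_part l \<ge> 0" if l: "l < r - 1" for l
  proof (cases "l = 0")
    case True
    obtain n where n: "r = n + 2"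
      using l by (intro that[of "r - 2"]) simp
    have "2 * r - 3 - l = 2 * n + 1"
      using True n by simp
    then have "F2_part l = (- q) ^ n * \<kappa> * K"
      using RK[of T T] frame True by (simp only: F2_part_def D) (simp add: D Rc hc)
    then have "(- 1) ^ (r - 1) * \<kappa> * F2_part l = - (((- 1) ^ n * (- q) ^ n) * (\<kappa>\<^sup>2 * K))"
      by (simp add: n power2_eq_square)
    also have "\<dots> \<ge> 0"
      unfolding sgn using \<open>q > 0\<close> \<open>K \<le> 0\<close> by (simp add: mult_nonneg_nonpos)
    finally show ?thesis .
  next
    case False
    \<comment> \<open>Both parities of \<open>l\<close> are indexed by \<open>b\<close>. The
      complementary index \<open>2 * r - 3 - l\<close> has the other parity and is indexed by
      \<open>a\<close>, where \<open>a + b = r - 3\<close>, so one argument is a multiple of F2 in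
      either case.\<close>
    obtain b where b: "l = 2 * b + 1 \<or> l = 2 * b + 2"
      using False by (intro that[of "(l - 1) div 2"]) presburger
    define a where "a = r - 3 - b"
    have r: "r = a + b + 3"
      using l b by (auto simp: a_def)
    have "F2_part l = - ((- q) ^ (a + b) * \<kappa> ^ 3 * K)"
      using b
    proof
      \<comment> \<open>Here F2 is in the second slot; the sign from swapping the slots cancels the
        sign \<open>(- 1) ^ l\<close>, so the value is the same as for even
        \<open>l\<close>.\<close>
      assume "l = 2 * b + 1"
      moreover from this have "2 * r - 3 - l = 2 * a + 2"
        using r by simp
      ultimately show ?thesis
        using Rm Rs[of "- \<kappa> *\<^sub>R T + \<theta> *\<^sub>R F3 c t" "F2 c t" T]
        by (simp only: F2_part_def D) (simp add: Rc hc power_add power3_eq_cube)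
    next
      assume "l = 2 * b + 2"
      moreover from this have "2 * r - 3 - l = 2 * a + 1"
        using r by simp
      ultimately show ?thesis
        using Rm by (simp only: F2_part_def D) (simp add: Rc hc power_add power3_eq_cube)
    qed
    then have "(- 1) ^ (r - 1) * \<kappa> * F2_part l = - (((- 1) ^ (a + b) * (- q) ^ (a + b)) * (\<kappa> ^ 4 * K))"
      by (simp add: r power3_eq_cube power4_eq_xxxx)
    also have "\<dots> \<ge> 0"
      unfolding sgn using \<open>q > 0\<close> \<open>K \<le> 0\<close> by (simp add: mult_nonneg_nonpos)
    finally show ?thesis .
  qed
  have "D (2 * r - 1) + (\<Sum>l<r - 1. (- 1) ^ l *\<^sub>R R (D (2 * r - 3 - l)) (D l) T) = 0"
    using harmonic c t by (simp add: r_harmonic_def D_def R_def T_def x_def)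
  then have "h (D (2 * r - 1) + (\<Sum>l<r - 1. (- 1) ^ l *\<^sub>R R (D (2 * r - 3 - l)) (D l) T)) (F2 c t) = 0"
    by (simp add: h_def ip_zero_left)
  then have "h (D (2 * r - 1)) (F2 c t) + (\<Sum>l<r - 1. F2_part l) = 0"
    by (simp add: h_def ip_add_left ip_sum_left F2_part_def)
  moreover have "h (D (2 * r - 1)) (F2 c t) = (- q) ^ (r - 1) * \<kappa>"
  proof -
    \<comment> \<open>The leading derivative has odd index; \<open>r \<ge> 1\<close> makes the
      truncated subtraction exact.\<close>
    have "2 * r - 1 = 2 * (r - 1) + 1"
      using \<open>r \<ge> 1\<close> by simp
    then show ?thesis
      by (simp only: D hc frame)
  qed
  ultimately have "(- 1) ^ (r - 1) * \<kappa> * ((- q) ^ (r - 1) * \<kappa> + (\<Sum>l<r - 1. F2_part l)) = 0"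
    by simp
  \<comment> \<open>The factor \<open>(- 1) ^ (r - 1) * \<kappa>\<close> makes the leading term
    strictly positive and every curvature term nonnegative. For \<open>r = 1\<close> the sum is
    empty and the leading term alone gives the contradiction.\<close>
  then have "q ^ (r - 1) * \<kappa>\<^sup>2 + (\<Sum>l<r - 1. (- 1) ^ (r - 1) * \<kappa> * F2_part l) = 0"
    unfolding sgn[symmetric] sum_distrib_left[symmetric]
    by (simp add: algebra_simps power2_eq_square)
  moreover have "(\<Sum>l<r - 1. (- 1) ^ (r - 1) * \<kappa> * F2_part l) \<ge> 0"
    by (rule sum_nonneg) (use nonneg in auto)
  moreover have "q ^ (r - 1) * \<kappa>\<^sup>2 > 0"
    using \<open>q > 0\<close> \<open>\<kappa> \<noteq> 0\<close> by simp
  ultimately show False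
    by linarith
qed

theorem corollary1p2:
  fixes A :: "('m::{t2_space, second_countable_topology}, 3) chart set"
    and g :: "('m, 3) chart \<Rightarrow> real^3 \<Rightarrow> real^3^3"
    and K :: real and r :: nat
    and I :: "real set" and \<gamma> :: "real \<Rightarrow> 'm"
    and F2 F3 :: "('m, 3) field_along" and k \<tau> :: "real \<Rightarrow> real"
  assumes "r \<ge> 1"
    and "space_form A g K" and "K \<le> 0"
    and "is_interval I" and "interior I \<noteq> {}"
    and "r_harmonic A g r I \<gamma>"
    and "arclength_parametrized A g I \<gamma>"
    and "frenet_frame A g I \<gamma> F2 F3 k \<tau>"
    and "k constant_on I" and "\<tau> constant_on I"
  shows "geodesic A g I \<gamma>"
proof -
  obtain \<kappa> \<theta> where const: "\<And>t. t \<in> I \<Longrightarrow> k t = \<kappa>" "\<And>t. t \<in> I \<Longrightarrow> \<tau> t = \<theta>"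
    using assms(9,10) by (auto simp: constant_on_def)
  have "\<kappa> = 0"
    by (rule geodesic_curvature_zero[OF assms(1-6,8) const])
  \<comment> \<open>With vanishing curvature the first Frenet equation becomes the geodesic
    equation.\<close>
  then have "cov_deriv g I \<gamma> (velocity I \<gamma>) c t = 0" if "c \<in> A" "t \<in> I" "\<gamma> t \<in> cdom c" for c t
    using assms(8) that const(1)[of t] by (auto simp: frenet_frame_def Let_def)
  then show ?thesis
    using assms(6) by (simp add: geodesic_def r_harmonic_def)
qed

end
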